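(* For every $n\ge1$ there exists a bijection $\psi:\mathbf{I}_n(201)\to\mathbf{I}_n(210)$ which preserves the pattern $010$ (that is, $e$ contains $010$ if and only if $\psi(e)$ contains $010$) and preserves the triple of statistics $(\operatorname{zero},\operatorname{dist},\operatorname{satu})$. In particular, $|\mathbf{I}_n(010,201)|=|\mathbf{I}_n(010,210)|$ for every positive integer $n$.
   Context: An inversion sequence of length $n$ is an integer sequence $e=(e_1,\dots,e_n)$ with $0\le e_i\le i-1$ for all $1\le i\le n$. A word $w_1\cdots w_n$ contains a pattern $P=p_1\cdots p_k$ if there are $i_1<\cdots<i_k$ such that $w_{i_1}\cdots w_{i_k}$ is order isomorphic to $P$ (equal letters of $P$ corresponding to equal entries); otherwise it avoids $P$. $\mathbf{I}_n(P_1,\dots,P_r)$ denotes the set of inversion sequences of length $n$ avoiding all of $P_1,\dots,P_r$. For $e\in\mathbf{I}_n$: $\operatorname{zero}(e)=|\{i\in[n]:e_i=0\}|$; $\operatorname{dist}(e)=|\{e_1,\dots,e_n\}\setminus\{0\}|$ is the number of distinct positive entries; $\operatorname{satu}(e)=|\{i\in[n]:e_i=i-1\}|$. *)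

theory Defs
  imports Main "HOL-Library.Sublist"
begin

(* Words are 0-indexed lists: the paper's e_i is e ! (i - 1).  Hence the condition
   0 <= e_i <= i - 1 reads e ! i <= i, and e_i = i - 1 reads e ! i = i. *)

definition inv_seqs :: "nat \<Rightarrow> nat list set" where
  "inv_seqs n = {e. length e = n \<and> (\<forall>i<n. e ! i \<le> i)}"

(* Since i and j are arbitrary, equal letters of u correspond to equal letters of v. *)
definition order_isomorphic :: "nat list \<Rightarrow> nat list \<Rightarrow> bool" where
  "order_isomorphic u v \<longleftrightarrow>
     length u = length v \<and>
     (\<forall>i<length u. \<forall>j<length u. u ! i < u ! j \<longleftrightarrow> v ! i < v ! j)"

(* subseq: not necessarily contiguous subwords *)
definition contains_pattern :: "nat list \<Rightarrow> nat list \<Rightarrow> bool" where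
  "contains_pattern w p \<longleftrightarrow> (\<exists>u. subseq u w \<and> order_isomorphic u p)"

definition inv_seqs_avoiding :: "nat \<Rightarrow> nat list set \<Rightarrow> nat list set" where
  "inv_seqs_avoiding n P = {e \<in> inv_seqs n. \<forall>p\<in>P. \<not> contains_pattern e p}"

definition zero_stat :: "nat list \<Rightarrow> nat" where
  "zero_stat e = card {i. i < length e \<and> e ! i = 0}"

definition dist_stat :: "nat list \<Rightarrow> nat" where
  "dist_stat e = card (set e - {0})"

definition satu_stat :: "nat list \<Rightarrow> nat" where
  "satu_stat e = card {i. i < length e \<and> e ! i = i}"

end

theory Submission
  imports Defs "HOL-Library.Multiset"
begin

text \<open>Call an entry of a word a top if it is at least every earlier entry, and a bottom otherwise.
  A bottom lies below some earlier top, so an inversion sequence remains one if its bottoms are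
  exchanged while every position keeps its role and every top keeps its value. Tops never take part
  in a pattern 201 or 210 except as the letter 2, and therefore each of the two patterns is avoided
  iff every bottom stands in a suitable relation to the later entries: for 210 the bottoms increase
  weakly, and for 201 each bottom is at least every later entry that lies below the current maximum.

  Fix the positions and values of the tops and the multiset of bottoms. Reading from left to right,
  avoiding 210 forces the least remaining bottom to be used, and avoiding 201 forces the greatest
  remaining one that lies below the current maximum. So there is at most one avoider of either kind.
  Neither choice can lead to a dead end: the current maximum never decreases, so a remaining bottom
  that fits now fits at every later bottom position too, and it can be swapped with the one used now
  in any given arrangement (\<open>fills_exchange\<close>). Hence every class of words with the same tops and
  the same bottoms has exactly one 201-avoider and exactly one 210-avoider
  (\<open>obeying_filling_exists\<close>, \<open>obeying_filling_unique\<close>). The three statistics are constant on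
  each class, which proves their equidistribution.

  This matching does not respect 010. For example, it pairs 00032231, which avoids 010, with 00031232,
  which does not. For 010-avoiders a finer class is used: a bottom that repeats the entry
  just before it is only recorded as a repetition, and the multiset consists of the other, fresh
  bottoms. Among the words avoiding 201 or 210, those avoiding 010 are exactly the ones whose fresh
  bottoms are distinct from one another and from all tops (\<open>unrepeated_iff_avoids_010\<close>), which is
  a property of the class; and the argument above applies unchanged to the fresh bottoms. So the
  three statistics are equidistributed over the 010-avoiders as well, and by subtraction over the
  words containing 010. A bijection is then assembled fibre by fibre.\<close>

section \<open>Skeletons and their fillings\<close>

text \<open>A skeleton records the values of the tops and, for each bottom, whether it is fresh or copies
  the entry just before it.\<close>

datatype slot = Top nat | New | Rep

text \<open>In \<open>fills p m s R w\<close>, the word \<open>w\<close> follows a prefix with last entry \<open>p\<close> and maximum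
  \<open>m\<close>, and \<open>R\<close> is the multiset of fresh bottoms that \<open>w\<close> uses. A fresh bottom may equal \<open>p\<close>;
  so a word with two equal adjacent bottoms fills skeletons with and without \<open>Rep\<close>. A \<open>Rep\<close> slot
  requires \<open>p < m\<close>, since a copy of the current maximum would be a top.\<close>

inductive fills :: "nat \<Rightarrow> nat \<Rightarrow> slot list \<Rightarrow> nat multiset \<Rightarrow> nat list \<Rightarrow> bool" where
  Nil: "fills p m [] {#} []"
| Top: "m \<le> v \<Longrightarrow> fills v v s R w \<Longrightarrow> fills p m (Top v # s) R (v # w)"
| New: "x < m \<Longrightarrow> fills x m s R w \<Longrightarrow> fills p m (New # s) (add_mset x R) (x # w)"
| Rep: "p < m \<Longrightarrow> fills p m s R w \<Longrightarrow> fills p m (Rep # s) R (p # w)"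

inductive_cases fills_NilE: "fills p m [] R w"
inductive_cases fills_TopE: "fills p m (Top v # s) R w"
inductive_cases fills_NewE: "fills p m (New # s) R w"
inductive_cases fills_RepE: "fills p m (Rep # s) R w"

text \<open>The previous entry matters only to an initial run of \<open>Rep\<close> slots, which copy it.\<close>

lemma fills_change_previous:
  assumes "fills p m s R w" "q < m"
  shows "\<exists>w'. fills q m s R w'"
  using assms by (induction arbitrary: q) (blast intro: fills.intros)+

text \<open>The maximum only grows along the word, so a value below the present maximum is a bottom wherever
  it is put. This is why the order in which the fresh bottoms are chosen does not matter for
  completing a filling.\<close>

lemma fills_exchange:
  assumes "fills p m s R w" "y \<in># R" "x < m"
  shows "\<exists>w'. fills p m s (add_mset x (R - {#y#})) w'"
  using assms
proof (induction)
  case (Nil p m)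
  then show ?case by simp
next
  case (Top m v s R w p)
  then show ?case by (meson fills.Top less_le_trans)
next
  case (New z m s R w p)
  show ?case
  proof (cases "y = z")
    case True
    obtain w' where "fills x m s R w'"
      using fills_change_previous New by blast
    then have "fills p m (New # s) (add_mset x R) (x # w')"
      using \<open>x < m\<close> by (rule fills.New[rotated])
    then show ?thesis using True by auto
  next
    case False
    then have "y \<in># R" using New by simp
    then obtain w' where "fills z m s (add_mset x (R - {#y#})) w'"
      using New by blast
    from fills.New[OF \<open>z < m\<close> this, of p] show ?thesis
      using False \<open>y \<in># R\<close> by (auto simp: add_mset_commute)
  qed
next
  case (Rep p m s R w)
  then show ?case by (meson fills.Rep)
qed

lemma fills_length: "fills p m s R w \<Longrightarrow> length s = length w"
  by (induction rule: fills.induct) auto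

lemma fills_fresh_subset: "fills p m s R w \<Longrightarrow> set_mset R \<subseteq> set w"
  by (induction rule: fills.induct) auto

lemma fills_tops_subset: "fills p m s R w \<Longrightarrow> Top v \<in> set s \<Longrightarrow> v \<in> set w"
  by (induction rule: fills.induct) auto

lemma fills_letter_cases:
  assumes "fills p m s R w" "y \<in> set w"
  shows "m \<le> y \<and> Top y \<in> set s \<or> y \<in># R \<or> y = p \<and> p < m"
  using assms by (induction) auto

text \<open>A bottom is smaller than an earlier top; the bound \<open>m\<close> stands for the tops of the prefix.\<close>

lemma fills_nth_cases:
  assumes "fills p m s R w" "i < length w"
  shows "s ! i = Top (w ! i) \<or> (\<forall>v. s ! i \<noteq> Top v) \<and>
           (w ! i < m \<or> (\<exists>j<i. \<exists>v. s ! j = Top v \<and> w ! i < v))"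
  using assms
proof (induction arbitrary: i)
  case (Top m v s R w p)
  show ?case
  proof (cases i)
    case (Suc k)
    have "s ! k = Top (w ! k) \<or> (\<forall>v. s ! k \<noteq> Top v) \<and>
       (w ! k < v \<or> (\<exists>j<k. \<exists>v. s ! j = Top v \<and> w ! k < v))"
      using Top Suc by auto
    then show ?thesis using Suc by (auto simp: Ex_less_Suc2)
  qed auto
next
  case (New x m s R w p)
  show ?case
  proof (cases i)
    case (Suc k)
    then show ?thesis using New.IH[of k] New.prems by (auto simp: Ex_less_Suc2)
  qed (use New in auto)
next
  case (Rep p m s R w)
  show ?case
  proof (cases i)
    case (Suc k)
    then show ?thesis using Rep.IH[of k] Rep.prems by (auto simp: Ex_less_Suc2)
  qed (use Rep in auto)
qed auto

text \<open>Copies made by \<open>Rep\<close> slots are counted neither as tops nor in \<open>R\<close>, so the multiplicity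
  of a value that may be copied is not determined.\<close>

lemma fills_count:
  assumes "fills p m s R w" "Rep \<notin> set s \<or> y \<notin># R \<and> (p < m \<longrightarrow> y \<noteq> p)"
  shows "count (mset w) y = count_list s (Top y) + count R y"
  using assms by (induction) auto

section \<open>Greedy fillings\<close>

text \<open>The relation \<open>ok m x y\<close> says that \<open>y\<close> may come after the bottom \<open>x\<close> that was placed when the
  maximum was \<open>m\<close>; no condition is imposed on what follows a top.\<close>

fun obeys :: "(nat \<Rightarrow> nat \<Rightarrow> nat \<Rightarrow> bool) \<Rightarrow> nat \<Rightarrow> nat list \<Rightarrow> bool" where
  "obeys ok m [] = True"
| "obeys ok m (x # w) =
     (if x < m then (\<forall>y\<in>set w. ok m x y) \<and> obeys ok m w else obeys ok x w)"

text \<open>What is common to the two rules of choice: tops are always admitted, and every supply of bottoms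
  that has an element below \<open>m\<close> has exactly one such element that may precede all the others.\<close>

locale priority_rule =
  fixes ok :: "nat \<Rightarrow> nat \<Rightarrow> nat \<Rightarrow> bool"
  assumes ok_refl: "ok m x x"
    and ok_top: "x < m \<Longrightarrow> m \<le> y \<Longrightarrow> ok m x y"
    and ok_antisym: "x < m \<Longrightarrow> y < m \<Longrightarrow> ok m x y \<Longrightarrow> ok m y x \<Longrightarrow> x = y"
    and ok_best: "finite A \<Longrightarrow> z \<in> A \<Longrightarrow> z < m \<Longrightarrow> \<exists>x\<in>A. x < m \<and> (\<forall>y\<in>A. ok m x y)"
begin

text \<open>At each fresh slot the best remaining value is used. By the exchange argument the rest of the
  skeleton can still be filled. The second hypothesis says that the entry to be copied by an initial
  \<open>Rep\<close> was itself a best choice.\<close>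

lemma obeying_filling_exists:
  assumes "fills p m s R w" "p < m \<Longrightarrow> \<forall>y\<in>#R. ok m p y"
  shows "\<exists>w'. fills p m s R w' \<and> obeys ok m w'"
  using assms
proof (induction s arbitrary: p m R w)
  case Nil
  then show ?case by (auto elim!: fills_NilE intro!: exI[of _ "[]"] fills.Nil)
next
  case (Cons a s)
  show ?case
  proof (cases a)
    case (Top v)
    with Cons.prems obtain w0 where "m \<le> v" "fills v v s R w0"
      by (auto elim: fills_TopE)
    moreover from this Cons.IH[of v v R w0] obtain w' where "fills v v s R w'" "obeys ok v w'"
      by auto
    ultimately show ?thesis using Top fills.Top by (intro exI[of _ "v # w'"]) auto
  next
    case New
    with Cons.prems obtain z S w0 where z: "z < m" "R = add_mset z S" "fills z m s S w0"
      by (auto elim: fills_NewE)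
    obtain x where x: "x \<in># R" "x < m" "\<forall>y\<in>#R. ok m x y"
      using ok_best[of "set_mset R" z m] z by auto
    have "\<exists>w1. fills x m s (R - {#x#}) w1"
    proof (cases "x = z")
      case True
      then show ?thesis using z by auto
    next
      case False
      then have "x \<in># S" using x z by simp
      then obtain w1 where "fills z m s (add_mset z (S - {#x#})) w1"
        using fills_exchange z by blast
      then show ?thesis using fills_change_previous \<open>x < m\<close> False z \<open>x \<in># S\<close> by auto
    qed
    then obtain w' where w': "fills x m s (R - {#x#}) w'" "obeys ok m w'"
      using Cons.IH x by (metis in_diffD)
    have "ok m x y" if "y \<in> set w'" for y
      using fills_letter_cases[OF w'(1) that] x ok_refl ok_top by (auto dest: in_diffD)
    moreover have "fills p m (a # s) R (x # w')"
      using fills.New[OF \<open>x < m\<close> w'(1), of p] x New by simp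
    ultimately show ?thesis using w' x by (intro exI[of _ "x # w'"]) auto
  next
    case Rep
    with Cons.prems obtain w0 where "p < m" "fills p m s R w0"
      by (auto elim: fills_RepE)
    moreover from this Cons obtain w' where w': "fills p m s R w'" "obeys ok m w'"
      by blast
    moreover have "ok m p y" if "y \<in> set w'" for y
      using fills_letter_cases[OF w'(1) that] Cons.prems(2) \<open>p < m\<close> ok_refl ok_top by auto
    ultimately show ?thesis using Rep fills.Rep by (intro exI[of _ "p # w'"]) auto
  qed
qed

text \<open>If two obeying fillings differ for the first time at a fresh slot, then each of the two values
  occurs later in the other filling, so each may precede the other, against antisymmetry.\<close>

lemma obeying_filling_unique:
  assumes "fills p m s R w" "obeys ok m w" "fills p m s R w'" "obeys ok m w'"
  shows "w = w'"
  using assms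
proof (induction arbitrary: w')
  case (Nil p m)
  then show ?case by (auto elim: fills_NilE)
next
  case (Top m v s R w p)
  from Top.prems(2) obtain u where "w' = v # u" "fills v v s R u"
    by (auto elim: fills_TopE)
  then show ?case using Top by auto
next
  case (New x m s R w p)
  from New.prems(2) obtain x' R' u
    where u: "w' = x' # u" "x' < m" "add_mset x R = add_mset x' R'" "fills x' m s R' u"
    by (auto elim: fills_NewE)
  have "x = x'"
  proof (rule ccontr)
    assume "x \<noteq> x'"
    then have "x' \<in># R" "x \<in># R'"
      using insert_noteq_member[OF u(3)] insert_noteq_member[OF u(3)[symmetric]] by blast+
    then have "x' \<in> set w" "x \<in> set u"
      using fills_fresh_subset[OF New.hyps(2)] fills_fresh_subset[OF u(4)] by auto
    then have "ok m x x'" "ok m x' x"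
      using New.prems(1,3) New.hyps(1) u(1,2) by simp_all
    then show False
      using ok_antisym New.hyps(1) u(2) \<open>x \<noteq> x'\<close> by blast
  qed
  moreover from this have "R = R'" using u(3) by simp
  ultimately show ?case
    using New.IH[of u] New.prems(1,3) New.hyps(1) u(1,4) by simp
next
  case (Rep p m s R w)
  from Rep.prems(2) obtain u where "w' = p # u" "fills p m s R u"
    by (auto elim: fills_RepE)
  then show ?case using Rep by auto
qed

text \<open>On a union \<open>X\<close> of complete classes, the obeying words form a system of representatives. The
  right-hand side does not mention the rule, so any two rules give the same cardinality.\<close>

lemma card_obeying_representatives:
  assumes fills: "\<And>e. e \<in> X \<Longrightarrow> fills 0 0 (S e) (F e) e"
    and closed: "\<And>e e'. e \<in> X \<Longrightarrow> fills 0 0 (S e) (F e) e' \<Longrightarrow> e' \<in> X \<and> S e' = S e \<and> F e' = F e"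
  shows "card {e \<in> X. obeys ok 0 e} = card ((\<lambda>e. (S e, F e)) ` X)"
proof (rule bij_betw_same_card)
  show "bij_betw (\<lambda>e. (S e, F e)) {e \<in> X. obeys ok 0 e} ((\<lambda>e. (S e, F e)) ` X)"
    unfolding bij_betw_def
  proof
    show "inj_on (\<lambda>e. (S e, F e)) {e \<in> X. obeys ok 0 e}"
    proof (rule inj_onI)
      fix e e'
      assume e: "e \<in> {e \<in> X. obeys ok 0 e}" "e' \<in> {e \<in> X. obeys ok 0 e}"
        and "(S e, F e) = (S e', F e')"
      then have "fills 0 0 (S e) (F e) e" "fills 0 0 (S e) (F e) e'"
        using fills[of e] fills[of e'] by auto
      then show "e = e'" using obeying_filling_unique e by blast
    qed
    show "(\<lambda>e. (S e, F e)) ` {e \<in> X. obeys ok 0 e} = (\<lambda>e. (S e, F e)) ` X"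
    proof (intro equalityI subsetI)
      fix k assume "k \<in> (\<lambda>e. (S e, F e)) ` X"
      then obtain e where e: "e \<in> X" "k = (S e, F e)" by auto
      obtain e' where e': "fills 0 0 (S e) (F e) e'" "obeys ok 0 e'"
        using obeying_filling_exists[OF fills[OF e(1)]] by auto
      then show "k \<in> (\<lambda>e. (S e, F e)) ` {e \<in> X. obeys ok 0 e}"
        using closed[OF e(1) e'(1)] e(2) e'(2) by (intro image_eqI[of _ _ e']) auto
    qed auto
  qed
qed

end

text \<open>Only entries below the maximum \<open>m\<close> are compared: an entry at least \<open>m\<close> completes no 201
  with the bottom \<open>x\<close> and the current maximum.\<close>

definition ok_201 :: "nat \<Rightarrow> nat \<Rightarrow> nat \<Rightarrow> bool" where
  "ok_201 m x y \<longleftrightarrow> (y < m \<longrightarrow> y \<le> x)"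

definition ok_210 :: "nat \<Rightarrow> nat \<Rightarrow> nat \<Rightarrow> bool" where
  "ok_210 m x y \<longleftrightarrow> x \<le> y"

interpretation rule_201: priority_rule ok_201
proof
  fix A :: "nat set" and z m :: nat
  assume A: "finite A" "z \<in> A" "z < m"
  define x where "x = Max {y \<in> A. y < m}"
  have "x \<in> {y \<in> A. y < m}"
    unfolding x_def by (rule Max_in) (use A in auto)
  moreover have "y \<le> x" if "y \<in> A" "y < m" for y
    unfolding x_def by (rule Max_ge) (use A that in auto)
  ultimately show "\<exists>x\<in>A. x < m \<and> (\<forall>y\<in>A. ok_201 m x y)"
    unfolding ok_201_def by blast
qed (auto simp: ok_201_def)

interpretation rule_210: priority_rule ok_210
proof
  fix A :: "nat set" and z m :: nat
  assume A: "finite A" "z \<in> A" "z < m"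
  then have "Min A \<in> A" "Min A < m" "\<forall>y\<in>A. Min A \<le> y"
    using Min_in[of A] Min_le[of A] le_less_trans[of "Min A" z m] by blast+
  then show "\<exists>x\<in>A. x < m \<and> (\<forall>y\<in>A. ok_210 m x y)"
    unfolding ok_210_def by blast
qed (auto simp: ok_210_def)

section \<open>Patterns of length three\<close>

(* Keeps the letter 1 in patterns such as [2, 0, 1] from being rewritten to Suc 0, and lets the
   recursion subseq_Cons_iff below, which has no case distinction, replace the default rule. *)
declare One_nat_def [simp del] subseq_Cons2_iff [simp del]

lemma order_isomorphic_three:
  "order_isomorphic u [x, y, z] \<longleftrightarrow> (\<exists>a b c. u = [a, b, c] \<and>
     (a < b \<longleftrightarrow> x < y) \<and> (b < a \<longleftrightarrow> y < x) \<and> (a < c \<longleftrightarrow> x < z) \<and> (c < a \<longleftrightarrow> z < x) \<and>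
     (b < c \<longleftrightarrow> y < z) \<and> (c < b \<longleftrightarrow> z < y))"
proof (cases "length u = 3")
  case True
  then obtain a b c where "u = [a, b, c]"
    by (auto simp: numeral_3_eq_3 length_Suc_conv)
  then show ?thesis
    by (auto simp: order_isomorphic_def All_less_Suc2)
qed (auto simp: order_isomorphic_def)

lemma subseq_Cons_iff:
  "subseq (a # u) (x # w) \<longleftrightarrow> subseq (a # u) w \<or> a = x \<and> subseq u w"
  by (metis subseq_Cons' subseq_Cons2 subseq_Cons2_iff subseq_Cons2_neq list_emb_Cons)

lemma subseq_singleton_iff: "subseq [a] w \<longleftrightarrow> a \<in> set w"
  by (induction w) (auto simp: subseq_Cons_iff)

lemma contains_pattern_three:
  "contains_pattern w [x, y, z] \<longleftrightarrow> (\<exists>a b c. subseq [a, b, c] w \<and>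
     (a < b \<longleftrightarrow> x < y) \<and> (b < a \<longleftrightarrow> y < x) \<and> (a < c \<longleftrightarrow> x < z) \<and> (c < a \<longleftrightarrow> z < x) \<and>
     (b < c \<longleftrightarrow> y < z) \<and> (c < b \<longleftrightarrow> z < y))"
  unfolding contains_pattern_def order_isomorphic_three by blast

lemma contains_201_iff:
  "contains_pattern w [2, 0, 1] \<longleftrightarrow> (\<exists>a b c. subseq [a, b, c] w \<and> b < c \<and> c < a)"
  unfolding contains_pattern_three
  by (intro arg_cong[of _ _ Ex] ext) auto

lemma contains_210_iff:
  "contains_pattern w [2, 1, 0] \<longleftrightarrow> (\<exists>a b c. subseq [a, b, c] w \<and> c < b \<and> b < a)"
  unfolding contains_pattern_three
  by (intro arg_cong[of _ _ Ex] ext) auto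

lemma contains_010_iff:
  "contains_pattern w [0, 1, 0] \<longleftrightarrow> (\<exists>a b. subseq [a, b, a] w \<and> a < b)"
proof -
  have "contains_pattern w [0, 1, 0] \<longleftrightarrow> (\<exists>a b c. subseq [a, b, c] w \<and> a < b \<and> c = a)"
    unfolding contains_pattern_three
    by (intro arg_cong[of _ _ Ex] ext conj_cong refl) auto
  then show ?thesis by simp
qed

lemma contains_010_Cons:
  "contains_pattern (x # w) [0, 1, 0] \<longleftrightarrow>
     contains_pattern w [0, 1, 0] \<or> (\<exists>b>x. subseq [b, x] w)"
  unfolding contains_010_iff subseq_Cons_iff by blast

lemma subseq_pair_iff: "subseq [b, c] (x # w) \<longleftrightarrow> subseq [b, c] w \<or> b = x \<and> c \<in> set w"
  using subseq_Cons'[of b "[c]" w] by (auto simp: subseq_Cons_iff subseq_singleton_iff)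

lemma contains_201_Cons:
  "contains_pattern (x # w) [2, 0, 1] \<longleftrightarrow>
     contains_pattern w [2, 0, 1] \<or> (\<exists>b c. subseq [b, c] w \<and> b < c \<and> c < x)"
  unfolding contains_201_iff subseq_Cons_iff by blast

lemma contains_210_Cons:
  "contains_pattern (x # w) [2, 1, 0] \<longleftrightarrow>
     contains_pattern w [2, 1, 0] \<or> (\<exists>b c. subseq [b, c] w \<and> c < b \<and> b < x)"
  unfolding contains_210_iff subseq_Cons_iff by blast

text \<open>If the first letter of an occurrence lies in the prefix and the other two do not, then the
  maximum \<open>m\<close> of the prefix can replace it. So the single letter \<open>m\<close> represents the prefix.\<close>

lemma obeys_201_iff: "obeys ok_201 m w \<longleftrightarrow> \<not> contains_pattern (m # w) [2, 0, 1]"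
proof (induction w arbitrary: m)
  case Nil
  then show ?case by (simp add: contains_201_iff subseq_Cons_iff)
next
  case (Cons x w)
  let ?pair = "\<lambda>m. \<exists>b c. subseq [b, c] w \<and> b < c \<and> c < m"
  have pair: "(\<exists>b c. subseq [b, c] (x # w) \<and> b < c \<and> c < m) \<longleftrightarrow>
      ?pair m \<or> (\<exists>c\<in>set w. x < c \<and> c < m)"
    unfolding subseq_pair_iff by blast
  have mono: "?pair k \<Longrightarrow> k \<le> l \<Longrightarrow> ?pair l" for k l
    by (meson less_le_trans)
  have step: "contains_pattern (m # x # w) [2, 0, 1] \<longleftrightarrow>
      contains_pattern w [2, 0, 1] \<or> ?pair x \<or> ?pair m \<or> (\<exists>c\<in>set w. x < c \<and> c < m)"
    unfolding contains_201_Cons[of m] pair contains_201_Cons[of x] by blast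
  show ?case
  proof (cases "x < m")
    case True
    then have "obeys ok_201 m (x # w) \<longleftrightarrow>
        \<not> (\<exists>c\<in>set w. x < c \<and> c < m) \<and> \<not> contains_pattern w [2, 0, 1] \<and> \<not> ?pair m"
      by (auto simp: Cons.IH ok_201_def contains_201_Cons not_le)
    then show ?thesis using step mono[of x m] True by auto
  next
    case False
    then have "obeys ok_201 m (x # w) \<longleftrightarrow> \<not> contains_pattern w [2, 0, 1] \<and> \<not> ?pair x"
      by (simp add: Cons.IH contains_201_Cons)
    then show ?thesis using step mono[of m x] False by auto
  qed
qed

lemma obeys_210_iff: "obeys ok_210 m w \<longleftrightarrow> \<not> contains_pattern (m # w) [2, 1, 0]"
proof (induction w arbitrary: m)
  case Nil
  then show ?case by (simp add: contains_210_iff subseq_Cons_iff)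
next
  case (Cons x w)
  let ?pair = "\<lambda>m. \<exists>b c. subseq [b, c] w \<and> c < b \<and> b < m"
  have pair: "(\<exists>b c. subseq [b, c] (x # w) \<and> c < b \<and> b < m) \<longleftrightarrow>
      ?pair m \<or> (\<exists>c\<in>set w. c < x \<and> x < m)"
    unfolding subseq_pair_iff by blast
  have mono: "?pair k \<Longrightarrow> k \<le> l \<Longrightarrow> ?pair l" for k l
    by (meson less_le_trans)
  have step: "contains_pattern (m # x # w) [2, 1, 0] \<longleftrightarrow>
      contains_pattern w [2, 1, 0] \<or> ?pair x \<or> ?pair m \<or> (\<exists>c\<in>set w. c < x \<and> x < m)"
    unfolding contains_210_Cons[of m] pair contains_210_Cons[of x] by blast
  show ?case
  proof (cases "x < m")
    case True
    then have "obeys ok_210 m (x # w) \<longleftrightarrow>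
        \<not> (\<exists>c\<in>set w. c < x \<and> x < m) \<and> \<not> contains_pattern w [2, 1, 0] \<and> \<not> ?pair m"
      by (auto simp: Cons.IH ok_210_def contains_210_Cons not_le)
    then show ?thesis using step mono[of x m] True by auto
  next
    case False
    then have "obeys ok_210 m (x # w) \<longleftrightarrow> \<not> contains_pattern w [2, 1, 0] \<and> \<not> ?pair x"
      by (simp add: Cons.IH contains_210_Cons)
    then show ?thesis using step mono[of m x] False by auto
  qed
qed

section \<open>The skeleton of a word\<close>

text \<open>The flag \<open>c\<close> says whether a bottom equal to the entry just before it counts as a copy. All
  avoiders are treated with \<open>c = False\<close>, the 010-avoiders with \<open>c = True\<close>.\<close>

fun skeleton :: "bool \<Rightarrow> nat \<Rightarrow> nat \<Rightarrow> nat list \<Rightarrow> slot list" where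
  "skeleton c p m [] = []"
| "skeleton c p m (x # w) =
     (if m \<le> x then Top x # skeleton c x x w
      else if c \<and> x = p then Rep # skeleton c p m w
      else New # skeleton c x m w)"

fun fresh :: "bool \<Rightarrow> nat \<Rightarrow> nat \<Rightarrow> nat list \<Rightarrow> nat multiset" where
  "fresh c p m [] = {#}"
| "fresh c p m (x # w) =
     (if m \<le> x then fresh c x x w
      else if c \<and> x = p then fresh c p m w
      else add_mset x (fresh c x m w))"

lemma fills_skeleton: "fills p m (skeleton c p m w) (fresh c p m w) w"
  by (induction w arbitrary: p m) (auto intro: fills.intros)

lemma Rep_notin_skeleton_False: "Rep \<notin> set (skeleton False p m w)"
  by (induction w arbitrary: p m) auto

text \<open>A filling determines its skeleton once it is clear which bottoms are copies. With \<open>c = True\<close>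
  a fresh bottom must therefore never happen to equal the entry before it, which distinctness
  ensures.\<close>

lemma skeleton_filling:
  assumes "fills p m s R w"
    and "if c then (\<forall>x. count R x \<le> 1) \<and> (p < m \<longrightarrow> p \<notin># R) else Rep \<notin> set s"
  shows "skeleton c p m w = s \<and> fresh c p m w = R"
  using assms
proof (induction)
  case (New x m s R w p)
  have "x \<noteq> p \<or> \<not> c" using New by (auto split: if_splits)
  moreover have "count R y \<le> 1" "x \<notin># R" if c for y
  proof -
    have le: "count (add_mset x R) z \<le> 1" for z
      using New.prems that by (simp only: if_True)
    have "count R y \<le> count (add_mset x R) y" by simp
    then show "count R y \<le> 1" using le order_trans by blast
    show "x \<notin># R" using le[of x] by (simp add: not_in_iff One_nat_def)
  qed
  ultimately show ?case using New by (auto split: if_splits)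
qed (auto split: if_splits)

section \<open>Words avoiding 010\<close>

text \<open>The condition on \<open>p\<close>, the last entry of the prefix, makes an induction along the word
  possible. For the empty prefix \<open>p = 0\<close>, it says that no bottom is \<open>0\<close>.\<close>

definition unrepeated :: "nat \<Rightarrow> nat \<Rightarrow> nat list \<Rightarrow> bool" where
  "unrepeated p m w \<longleftrightarrow>
     (\<forall>x. count (fresh True p m w) x \<le> 1) \<and>
     (\<forall>x\<in>#fresh True p m w. Top x \<notin> set (skeleton True p m w)) \<and> p \<notin># fresh True p m w"

lemma fresh_if_below: "y \<in> set w \<Longrightarrow> y < m \<Longrightarrow> y \<noteq> p \<Longrightarrow> y \<in># fresh c p m w"
  using fills_letter_cases[OF fills_skeleton[of p m c w]] by fastforce

lemma fresh_subset: "y \<in># fresh c p m w \<Longrightarrow> y \<in> set w"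
  using fills_fresh_subset[OF fills_skeleton[of p m c w]] by auto

text \<open>The last letter \<open>a\<close> lies below \<open>b\<close>, so it is a bottom. The run of copies ending in it starts
  after \<open>b\<close>, because \<open>b \<noteq> a\<close>, and it starts with a fresh bottom.\<close>

lemma fresh_if_descent: "subseq [b, a] w \<Longrightarrow> a < b \<Longrightarrow> a \<in># fresh c p m w"
proof (induction w arbitrary: p m)
  case (Cons x w)
  then show ?case
    by (auto simp: subseq_pair_iff intro: fresh_if_below)
qed simp

text \<open>A fresh bottom lies below the maximum at its position, and if this value is at least \<open>m\<close>, a
  larger top must have come in between.\<close>

lemma descent_if_fresh: "a \<in># fresh c p m w \<Longrightarrow> m \<le> a \<Longrightarrow> \<exists>b>a. subseq [b, a] w"
proof (induction w arbitrary: p m)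
  case (Cons x w)
  show ?case
  proof (cases "a < x")
    case True
    have "a \<in> set w"
      using fresh_subset[OF Cons.prems(1)] True by auto
    then show ?thesis using True by (auto simp: subseq_pair_iff)
  next
    case False
    then show ?thesis
      using Cons by (fastforce simp: subseq_pair_iff split: if_splits)
  qed
qed simp

lemma skeleton_top_ge: "Top v \<in> set (skeleton c p m w) \<Longrightarrow> m \<le> v"
  by (induction w arbitrary: p m) (fastforce split: if_splits)+

text \<open>Prepending \<open>p\<close> to a word creates a new occurrence of 010 iff a larger entry and then \<open>p\<close>
  follow. It is to be shown that this happens iff \<open>p\<close> occurs again as a fresh bottom. If \<open>p\<close> is
  the current maximum, this holds for all words. If \<open>p\<close> is a bottom, the rule enters: before the
  next top, \<open>p\<close> can return only in a run of copies, since once another bottom \<open>x\<close> is placed,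
  \<open>p\<close> and \<open>x\<close> would have to precede each other.\<close>

lemma (in priority_rule) unrepeated_iff_avoids_010:
  assumes "p \<le> m" "obeys ok m (p # w)"
  shows "unrepeated p m w \<longleftrightarrow> \<not> contains_pattern (p # w) [0, 1, 0]"
  using assms
proof (induction w arbitrary: p m)
  case Nil
  then show ?case by (simp add: unrepeated_def contains_010_iff subseq_Cons_iff)
next
  case (Cons x w)
  consider (top) "m \<le> x" | (rep) "x < m" "x = p" | (new) "x < m" "x \<noteq> p" by linarith
  then show ?case
  proof cases
    case top
    have IH: "unrepeated x x w \<longleftrightarrow> \<not> contains_pattern (x # w) [0, 1, 0]"
      by (rule Cons.IH) (use top Cons.prems in \<open>auto split: if_splits\<close>)
    have "unrepeated p m (x # w) \<longleftrightarrow> unrepeated x x w \<and> p \<notin># fresh True x x w"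
      using top by (auto simp: unrepeated_def)
    moreover have "p \<in># fresh True x x w \<longleftrightarrow> (\<exists>b>p. subseq [b, p] (x # w))"
    proof (cases "p < x")
      case True
      then show ?thesis
        using fresh_if_below[of p w x x True] fresh_subset[of p True x x w]
        by (auto simp: subseq_pair_iff intro: fresh_if_descent)
    next
      case False
      then have "p = x" using top Cons.prems by simp
      then show ?thesis
        using descent_if_fresh[of x True x x w] by (auto simp: subseq_pair_iff intro: fresh_if_descent)
    qed
    ultimately show ?thesis using IH contains_010_Cons[of p "x # w"] by blast
  next
    case rep
    have "unrepeated p m w \<longleftrightarrow> \<not> contains_pattern (p # w) [0, 1, 0]"
      by (rule Cons.IH) (use rep Cons.prems in \<open>auto split: if_splits\<close>)
    moreover have "unrepeated p m (x # w) \<longleftrightarrow> unrepeated p m w"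
      using rep by (auto simp: unrepeated_def)
    ultimately show ?thesis
      using rep by (auto simp: contains_010_Cons subseq_pair_iff)
  next
    case new
    have IH: "unrepeated x m w \<longleftrightarrow> \<not> contains_pattern (x # w) [0, 1, 0]"
      by (rule Cons.IH) (use new Cons.prems in \<open>auto split: if_splits\<close>)
    \<comment> \<open>Later tops are at least the current maximum, so they cannot equal the bottom \<open>x\<close>.\<close>
    have "Top x \<notin> set (skeleton True x m w)"
      using new skeleton_top_ge by fastforce
    then have "unrepeated p m (x # w) \<longleftrightarrow> unrepeated x m w \<and> p \<notin># fresh True x m w"
      using new by (auto simp: unrepeated_def not_in_iff)
    moreover have "p \<in># fresh True x m w \<longleftrightarrow> (\<exists>b>p. subseq [b, p] (x # w))"
    proof (cases "p < m")
      case True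
      \<comment> \<open>Both \<open>p\<close> and \<open>x\<close> are bottoms, so neither side of the equivalence can hold.\<close>
      have "p \<notin> set w"
      proof
        assume "p \<in> set w"
        then have "ok m x p" "ok m p x"
          using Cons.prems new True by (auto split: if_splits)
        then show False using ok_antisym new True by blast
      qed
      moreover have "p \<in> set w" if "subseq [b, p] (x # w)" for b
        using that new by (auto simp: subseq_pair_iff dest: list_emb_set)
      ultimately show ?thesis using fresh_subset by blast
    next
      case False
      then show ?thesis
        using new Cons.prems descent_if_fresh[of p True x m w]
        by (auto simp: subseq_pair_iff intro: fresh_if_descent)
    qed
    ultimately show ?thesis using IH contains_010_Cons[of p "x # w"] by blast
  qed
qed

section \<open>Statistics\<close>

definition stats :: "nat list \<Rightarrow> nat \<times> nat \<times> nat" where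
  "stats e = (zero_stat e, dist_stat e, satu_stat e)"

lemma zero_stat_count: "zero_stat e = count (mset e) 0"
  unfolding zero_stat_def count_mset count_list_eq_length_filter length_filter_conv_card
  by (rule arg_cong[of _ _ card]) auto

text \<open>A bottom lies below a top at an earlier position \<open>j\<close>, whose value is at most \<open>j\<close>. So the
  bound for inversion sequences holds automatically at bottoms, and strictly.\<close>

lemma fills_inv_seqs_nth:
  assumes "fills 0 0 s R e" "e \<in> inv_seqs n" "fills 0 0 s R e'" "i < n"
  shows "s ! i = Top (e' ! i) \<and> e' ! i \<le> i \<or> (\<forall>v. s ! i \<noteq> Top v) \<and> e' ! i < i"
proof -
  have len: "length e = n" "length e' = n"
    using assms fills_length[OF assms(1)] fills_length[OF assms(3)] by (auto simp: inv_seqs_def)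
  have top: "v \<le> j" if "s ! j = Top v" "j < n" for j v
    using fills_nth_cases[OF assms(1), of j] that assms(2) len by (auto simp: inv_seqs_def)
  consider "s ! i = Top (e' ! i)"
    | j v where "\<forall>v. s ! i \<noteq> Top v" "j < i" "s ! j = Top v" "e' ! i < v"
    using fills_nth_cases[OF assms(3), of i] len assms(4) by auto
  then show ?thesis
  proof cases
    case 1
    then show ?thesis using top assms(4) by blast
  next
    case 2
    then have "v \<le> j" using top[of j v] assms(4) by simp
    then show ?thesis using 2 by simp
  qed
qed

lemma fills_inv_seqs:
  assumes "fills 0 0 s R e" "e \<in> inv_seqs n" "fills 0 0 s R e'"
  shows "e' \<in> inv_seqs n"
proof -
  have "length e' = n"
    using assms fills_length[OF assms(1)] fills_length[OF assms(3)] by (simp add: inv_seqs_def)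
  moreover have "e' ! i \<le> i" if "i < n" for i
    using fills_inv_seqs_nth[OF assms that] by auto
  ultimately show ?thesis by (simp add: inv_seqs_def)
qed

lemma satu_iff_top:
  assumes "fills 0 0 s R e" "e \<in> inv_seqs n" "i < n"
  shows "e ! i = i \<longleftrightarrow> s ! i = Top i"
  using fills_inv_seqs_nth[OF assms(1,2,1,3)] by auto

text \<open>The zeros are counted by the tops and the multiset, the set of values is the union of the tops
  and the fresh bottoms, and the saturated entries are all tops. Zeros that are copies would not be
  visible in the class, hence the last hypothesis.\<close>

lemma fills_stats:
  assumes e: "fills 0 0 s R e" "e \<in> inv_seqs n" and e': "fills 0 0 s R e'"
    and zero: "Rep \<notin> set s \<or> 0 \<notin># R"
  shows "stats e' = stats e"
proof -
  have e'n: "e' \<in> inv_seqs n" using fills_inv_seqs e e' by blast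
  have "zero_stat e' = zero_stat e"
    using fills_count[OF e(1)] fills_count[OF e'] zero by (simp add: zero_stat_count)
  moreover have "set w = {v. Top v \<in> set s} \<union> set_mset R" if "fills 0 0 s R w" for w
    using fills_letter_cases[OF that] fills_tops_subset[OF that] fills_fresh_subset[OF that]
    by auto
  then have "dist_stat e' = dist_stat e"
    using e(1) e' by (simp add: dist_stat_def)
  moreover have "satu_stat w = card {i. i < n \<and> s ! i = Top i}"
    if "fills 0 0 s R w" "w \<in> inv_seqs n" for w
  proof -
    have "length w = n" using that by (simp add: inv_seqs_def)
    then show ?thesis
      unfolding satu_stat_def
      by (intro arg_cong[of _ _ card] Collect_cong) (use satu_iff_top[OF that] in blast)
  qed
  then have "satu_stat e' = satu_stat e"
    using e e' e'n by simp
  ultimately show ?thesis by (simp add: stats_def)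
qed

section \<open>Equidistribution\<close>

text \<open>A nonempty inversion sequence already begins with \<open>0\<close>.\<close>

lemma contains_zero_Cons:
  assumes "e \<in> inv_seqs n"
  shows "contains_pattern (0 # e) [0, 1, 0] \<longleftrightarrow> contains_pattern e [0, 1, 0]"
proof (cases e)
  case (Cons x w)
  then have "x = 0" using assms by (auto simp: inv_seqs_def)
  then show ?thesis using Cons by (auto simp: contains_010_Cons subseq_pair_iff)
qed (simp add: contains_010_iff subseq_Cons_iff)

lemma obeys_201_zero: "obeys ok_201 0 e \<longleftrightarrow> \<not> contains_pattern e [2, 0, 1]"
  by (simp add: obeys_201_iff contains_201_Cons)

lemma obeys_210_zero: "obeys ok_210 0 e \<longleftrightarrow> \<not> contains_pattern e [2, 1, 0]"
  by (simp add: obeys_210_iff contains_210_Cons)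

text \<open>All classes without \<open>Rep\<close> slots are used here.\<close>

lemma card_avoiders_stats_eq:
  "card {e \<in> inv_seqs_avoiding n {[2,0,1]}. stats e = t} =
   card {e \<in> inv_seqs_avoiding n {[2,1,0]}. stats e = t}"
proof -
  let ?X = "{e \<in> inv_seqs n. stats e = t}"
  let ?S = "skeleton False 0 0" and ?F = "fresh False 0 0"
  have closed: "e' \<in> ?X \<and> ?S e' = ?S e \<and> ?F e' = ?F e"
    if e: "e \<in> ?X" and e': "fills 0 0 (?S e) (?F e) e'" for e e'
  proof -
    have "?S e' = ?S e \<and> ?F e' = ?F e"
      by (rule skeleton_filling[OF e']) (simp add: Rep_notin_skeleton_False)
    moreover have "stats e' = stats e"
      by (rule fills_stats[OF fills_skeleton _ e', of n])
        (use e in \<open>simp_all add: Rep_notin_skeleton_False\<close>)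
    moreover have "e' \<in> inv_seqs n"
      using e e' fills_inv_seqs[OF fills_skeleton] by blast
    ultimately show ?thesis using e by simp
  qed
  have "card {e \<in> ?X. obeys ok_201 0 e} = card ((\<lambda>e. (?S e, ?F e)) ` ?X)"
    by (rule rule_201.card_obeying_representatives[OF fills_skeleton closed])
  also have "\<dots> = card {e \<in> ?X. obeys ok_210 0 e}"
    by (rule rule_210.card_obeying_representatives[OF fills_skeleton closed, symmetric])
  finally have "card {e \<in> ?X. obeys ok_201 0 e} = card {e \<in> ?X. obeys ok_210 0 e}" .
  then show ?thesis
    by (simp add: obeys_201_zero obeys_210_zero inv_seqs_avoiding_def conj_ac)
qed

text \<open>Here copies are recorded. By \<open>unrepeated_iff_avoids_010\<close> with \<open>p = m = 0\<close>, avoiding 010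
  can be read off from the class.\<close>

lemma card_010_avoiders_stats_eq:
  "card {e \<in> inv_seqs_avoiding n {[2,0,1]}. \<not> contains_pattern e [0,1,0] \<and> stats e = t} =
   card {e \<in> inv_seqs_avoiding n {[2,1,0]}. \<not> contains_pattern e [0,1,0] \<and> stats e = t}"
proof -
  let ?X = "{e \<in> inv_seqs n. unrepeated 0 0 e \<and> stats e = t}"
  let ?S = "skeleton True 0 0" and ?F = "fresh True 0 0"
  have closed: "e' \<in> ?X \<and> ?S e' = ?S e \<and> ?F e' = ?F e"
    if e: "e \<in> ?X" and e': "fills 0 0 (?S e) (?F e) e'" for e e'
  proof -
    have "?S e' = ?S e \<and> ?F e' = ?F e"
      using e skeleton_filling[OF e', of True] by (simp add: unrepeated_def)
    moreover from this have "unrepeated 0 0 e'" using e by (simp add: unrepeated_def)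
    moreover have "stats e' = stats e"
      by (rule fills_stats[OF fills_skeleton _ e', of n]) (use e in \<open>simp_all add: unrepeated_def\<close>)
    moreover have "e' \<in> inv_seqs n"
      using e e' fills_inv_seqs[OF fills_skeleton] by blast
    ultimately show ?thesis using e by simp
  qed
  have "card {e \<in> ?X. obeys ok_201 0 e} = card ((\<lambda>e. (?S e, ?F e)) ` ?X)"
    by (rule rule_201.card_obeying_representatives[OF fills_skeleton closed])
  also have "\<dots> = card {e \<in> ?X. obeys ok_210 0 e}"
    by (rule rule_210.card_obeying_representatives[OF fills_skeleton closed, symmetric])
  finally have "card {e \<in> ?X. obeys ok_201 0 e} = card {e \<in> ?X. obeys ok_210 0 e}" .
  moreover have "{e \<in> ?X. obeys ok_201 0 e} =
      {e \<in> inv_seqs_avoiding n {[2,0,1]}. \<not> contains_pattern e [0,1,0] \<and> stats e = t}"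
    using rule_201.unrepeated_iff_avoids_010[of 0 0] contains_zero_Cons[of _ n]
    by (auto simp: obeys_201_zero inv_seqs_avoiding_def)
  moreover have "{e \<in> ?X. obeys ok_210 0 e} =
      {e \<in> inv_seqs_avoiding n {[2,1,0]}. \<not> contains_pattern e [0,1,0] \<and> stats e = t}"
    using rule_210.unrepeated_iff_avoids_010[of 0 0] contains_zero_Cons[of _ n]
    by (auto simp: obeys_210_zero inv_seqs_avoiding_def)
  ultimately show ?thesis by simp
qed

lemma finite_inv_seqs: "finite (inv_seqs n)"
proof (rule finite_subset)
  show "inv_seqs n \<subseteq> {e. set e \<subseteq> {..n} \<and> length e = n}"
    by (fastforce simp: inv_seqs_def in_set_conv_nth)
qed (simp add: finite_lists_length_eq)

lemma bij_betw_if_card_fibres_eq: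
  assumes fin: "finite A" "finite B"
    and card: "\<And>k. card {a \<in> A. f a = k} = card {b \<in> B. g b = k}"
  shows "\<exists>\<psi>. bij_betw \<psi> A B \<and> (\<forall>a\<in>A. g (\<psi> a) = f a)"
proof -
  have "\<exists>h. bij_betw h {a \<in> A. f a = k} {b \<in> B. g b = k}" for k
    by (rule finite_same_card_bij) (use fin card in auto)
  then obtain h where h: "\<And>k. bij_betw (h k) {a \<in> A. f a = k} {b \<in> B. g b = k}"
    by metis
  define \<psi> where "\<psi> a = h (f a) a" for a
  have img: "\<psi> a \<in> B \<and> g (\<psi> a) = f a" if "a \<in> A" for a
    using bij_betwE[OF h[of "f a"]] that by (simp add: \<psi>_def)
  have "inj_on \<psi> A"
  proof (rule inj_onI)
    fix a a' assume a: "a \<in> A" "a' \<in> A" "\<psi> a = \<psi> a'"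
    then have "f a = f a'" using img by metis
    then show "a = a'"
      using bij_betw_imp_inj_on[OF h[of "f a"]] a unfolding inj_on_def \<psi>_def by auto
  qed
  moreover have "b \<in> \<psi> ` A" if "b \<in> B" for b
  proof -
    have "b \<in> h (g b) ` {a \<in> A. f a = g b}"
      using bij_betw_imp_surj_on[OF h[of "g b"]] that by simp
    then obtain a where "a \<in> A" "f a = g b" "b = h (g b) a" by blast
    then show ?thesis by (intro image_eqI[of _ _ a]) (simp_all add: \<psi>_def)
  qed
  ultimately show ?thesis using img unfolding bij_betw_def by blast
qed

theorem theorem8p2:
  fixes n :: nat
  assumes "n \<ge> 1"
  shows "(\<exists>\<psi>. bij_betw \<psi> (inv_seqs_avoiding n {[2,0,1]}) (inv_seqs_avoiding n {[2,1,0]}) \<and>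
            (\<forall>e \<in> inv_seqs_avoiding n {[2,0,1]}.
               (contains_pattern e [0,1,0] \<longleftrightarrow> contains_pattern (\<psi> e) [0,1,0]) \<and>
               (zero_stat (\<psi> e), dist_stat (\<psi> e), satu_stat (\<psi> e)) =
                 (zero_stat e, dist_stat e, satu_stat e))) \<and>
         card (inv_seqs_avoiding n {[0,1,0], [2,0,1]}) =
           card (inv_seqs_avoiding n {[0,1,0], [2,1,0]})"
proof -
  let ?A = "inv_seqs_avoiding n {[2,0,1]}" and ?B = "inv_seqs_avoiding n {[2,1,0]}"
  let ?c = "\<lambda>e. contains_pattern e [0,1,0]"
  have fin: "finite ?A" "finite ?B"
    using finite_inv_seqs[of n] by (auto simp: inv_seqs_avoiding_def)
  have compl: "card {e \<in> C. ?c e \<and> stats e = t} =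
      card {e \<in> C. stats e = t} - card {e \<in> C. \<not> ?c e \<and> stats e = t}"
    if "finite C" for C :: "nat list set" and t
  proof -
    have "{e \<in> C. ?c e \<and> stats e = t} = {e \<in> C. stats e = t} - {e \<in> C. \<not> ?c e \<and> stats e = t}"
      by auto
    also have "card \<dots> = card {e \<in> C. stats e = t} - card {e \<in> C. \<not> ?c e \<and> stats e = t}"
      by (rule card_Diff_subset) (use that in auto)
    finally show ?thesis .
  qed
  have "card {e \<in> ?A. (?c e, stats e) = k} = card {e \<in> ?B. (?c e, stats e) = k}" for k
  proof -
    obtain q t where "k = (q, t)" by (cases k)
    then show ?thesis
      using card_avoiders_stats_eq[of n t] card_010_avoiders_stats_eq[of n t]
        compl[OF fin(1), of t] compl[OF fin(2), of t]
      by (cases q) simp_all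
  qed
  from bij_betw_if_card_fibres_eq[OF fin this]
  obtain \<psi> where \<psi>: "bij_betw \<psi> ?A ?B" and pres: "\<And>e. e \<in> ?A \<Longrightarrow> (?c (\<psi> e), stats (\<psi> e)) = (?c e, stats e)"
    by blast
  have avoiding: "bij_betw \<psi> {e \<in> ?A. \<not> ?c e} {e \<in> ?B. \<not> ?c e}"
    unfolding bij_betw_def
  proof
    show "inj_on \<psi> {e \<in> ?A. \<not> ?c e}"
      using \<psi> by (auto simp: bij_betw_def intro: inj_on_subset)
    show "\<psi> ` {e \<in> ?A. \<not> ?c e} = {e \<in> ?B. \<not> ?c e}"
    proof -
      have c: "?c (\<psi> e) \<longleftrightarrow> ?c e" if "e \<in> ?A" for e
        using pres[OF that] by simp
      have "{e \<in> ?B. \<not> ?c e} = {e \<in> \<psi> ` ?A. \<not> ?c e}"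
        using bij_betw_imp_surj_on[OF \<psi>] by simp
      also have "\<dots> = \<psi> ` {e \<in> ?A. \<not> ?c e}"
        using c by blast
      finally show ?thesis by simp
    qed
  qed
  have "{e \<in> ?A. \<not> ?c e} = inv_seqs_avoiding n {[0,1,0], [2,0,1]}"
    "{e \<in> ?B. \<not> ?c e} = inv_seqs_avoiding n {[0,1,0], [2,1,0]}"
    by (auto simp: inv_seqs_avoiding_def)
  then have "card (inv_seqs_avoiding n {[0,1,0], [2,0,1]}) =
      card (inv_seqs_avoiding n {[0,1,0], [2,1,0]})"
    using bij_betw_same_card[OF avoiding] by simp
  moreover have "(?c e \<longleftrightarrow> ?c (\<psi> e)) \<and> (zero_stat (\<psi> e), dist_stat (\<psi> e), satu_stat (\<psi> e)) =
      (zero_stat e, dist_stat e, satu_stat e)" if "e \<in> ?A" for e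
    using pres[OF that] by (simp add: stats_def)
  ultimately show ?thesis using \<psi> by blast
qed

end
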